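(* For every integer $n\ge 1$, $AP_n$ is similar to the disjoint union of two copies of $AD_{n-1}$, one copy of $S_{2n}$, and one copy of $S'_{2n}$.
   Context: The adjacency matrix of a weighted directed graph has rows and columns indexed by the vertices, its $(u,v)$-entry being the weight of the directed edge from $u$ to $v$ if there is one, and $0$ otherwise (a loop of weight $c$ at $u$ contributes the diagonal entry $c$). Undirected graphs are viewed as directed by replacing each edge by a pair of anti-parallel arcs of the same weight; unweighted edges have weight $1$, and for parallel edges the adjacency matrix entry is the number of parallel edges. Two graphs are called similar if their adjacency matrices are similar matrices. The Aztec diamond $AD_n$ is the subgraph of the grid $(\mathbb{Z}+1/2)^2$ (nearest-neighbor edges) induced by the vertices $(x,y)$ with $|x|+|y|\le n$ ($AD_0$ is empty). The Aztec pillowcase $AP_n$ is the graph obtained from two copies of $AD_n$ by identifying corresponding vertices on (the boundary of) their convex hull, i.e. the vertices with $|x|+|y|=n$; all edges of both copies are kept, which leads to four pairs of parallel edges. $P_m^{(q)}$ denotes the path on $m$ vertices with all edges weighted $q$. $S_m$ is the directed graph on $m$ vertices obtained from $P_{m-1}^{(2)}$ by regarding each edge as a pair of anti-parallel arcs of weight $2$, and including an extra vertex $v$, an arc of weight $2$ directed from $v$ to the rightmost (last) vertex of $P_{m-1}^{(2)}$, and a loop at $v$ of weight $4$. $S'_m$ is constructed analogously from $P_{m-1}^{(-2)}$: each edge becomes a pair of anti-parallel arcs of weight $-2$, the arc from the new vertex $v$ to the last vertex of the path has weight $-2$, and the loop at $v$ has weight $-4$. *)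

theory Defs
  imports Complex_Main "Graph_Theory.Digraph" "Jordan_Normal_Form.Matrix"
begin

section \<open>Weighted directed multigraphs and similarity\<close>

record ('a, 'b) wdigraph = "('a, 'b) pre_digraph" +
  weight :: "'b \<Rightarrow> real"

text \<open>Parallel arcs contribute the sum of their weights, so unweighted parallel edges
  are counted.\<close>

definition adj_entry :: "('a, 'b) wdigraph \<Rightarrow> 'a \<Rightarrow> 'a \<Rightarrow> real" where
  "adj_entry G u v = (\<Sum>e \<in> {e \<in> arcs G. tail G e = u \<and> head G e = v}. weight G e)"

definition adj_mat :: "('a, 'b) wdigraph \<Rightarrow> 'a list \<Rightarrow> real mat" where
  "adj_mat G vs = mat (length vs) (length vs) (\<lambda>(i, j). adj_entry G (vs ! i) (vs ! j))"

definition vertex_enum :: "('a, 'b) wdigraph \<Rightarrow> 'a list \<Rightarrow> bool" where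
  "vertex_enum G vs \<longleftrightarrow> distinct vs \<and> set vs = verts G"

text \<open>Finiteness and well-formedness are part of the notion: they guarantee that vertex
  enumerations exist (so that the quantification below is not vacuous) and that the sums in
  \<^const>\<open>adj_entry\<close> are finite. Changing an enumeration conjugates the adjacency matrix by a
  permutation matrix.\<close>

definition similar_graphs :: "('a, 'b) wdigraph \<Rightarrow> ('c, 'd) wdigraph \<Rightarrow> bool" where
  "similar_graphs G H \<longleftrightarrow>
     fin_digraph (pre_digraph.truncate G) \<and> fin_digraph (pre_digraph.truncate H) \<and>
     (\<forall>vs ws. vertex_enum G vs \<longrightarrow> vertex_enum H ws \<longrightarrow>
        similar_mat (adj_mat G vs) (adj_mat H ws))"


section \<open>Disjoint unions and identification of vertices\<close>

definition disj_union ::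
  "('a, 'b) wdigraph \<Rightarrow> ('c, 'd) wdigraph \<Rightarrow> ('a + 'c, 'b + 'd) wdigraph" where
  "disj_union G H =
     \<lparr>verts = verts G <+> verts H,
      arcs = arcs G <+> arcs H,
      tail = map_sum (tail G) (tail H),
      head = map_sum (head G) (head H),
      weight = case_sum (weight G) (weight H)\<rparr>"

text \<open>The quotient of a graph under the identification of all vertices with the same image
  under \<open>f\<close>. All arcs are kept, hence parallel arcs may arise.\<close>

definition identify_verts :: "('a \<Rightarrow> 'c) \<Rightarrow> ('a, 'b) wdigraph \<Rightarrow> ('c, 'b) wdigraph" where
  "identify_verts f G =
     \<lparr>verts = f ` verts G,
      arcs = arcs G,
      tail = f \<circ> tail G,
      head = f \<circ> head G,
      weight = weight G\<rparr>"


section \<open>Aztec diamonds and Aztec pillowcases\<close>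

type_synonym point = "real \<times> real"

definition half_grid :: "point set" where
  "half_grid = {(x, y). x - 1/2 \<in> \<int> \<and> y - 1/2 \<in> \<int>}"

definition nearest_neighbors :: "point \<Rightarrow> point \<Rightarrow> bool" where
  "nearest_neighbors p q \<longleftrightarrow> \<bar>fst p - fst q\<bar> + \<bar>snd p - snd q\<bar> = 1"

definition aztec_verts :: "nat \<Rightarrow> point set" where
  "aztec_verts n = {p \<in> half_grid. \<bar>fst p\<bar> + \<bar>snd p\<bar> \<le> real n}"

text \<open>An undirected edge \<open>{p, q}\<close> is represented by the two arcs \<open>(p, q)\<close> and \<open>(q, p)\<close>.\<close>

definition aztec_diamond :: "nat \<Rightarrow> (point, point \<times> point) wdigraph" where
  "aztec_diamond n =
     \<lparr>verts = aztec_verts n,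
      arcs = {(p, q). p \<in> aztec_verts n \<and> q \<in> aztec_verts n \<and> nearest_neighbors p q},
      tail = fst,
      head = snd,
      weight = (\<lambda>_. 1)\<rparr>"

text \<open>The common vertex arising from two corresponding boundary vertices is represented by
  the one in the first copy.\<close>

fun pillow_glue :: "nat \<Rightarrow> point + point \<Rightarrow> point + point" where
  "pillow_glue n (Inl p) = Inl p"
| "pillow_glue n (Inr p) = (if \<bar>fst p\<bar> + \<bar>snd p\<bar> = real n then Inl p else Inr p)"

definition aztec_pillowcase ::
  "nat \<Rightarrow> (point + point, point \<times> point + point \<times> point) wdigraph" where
  "aztec_pillowcase n =
     identify_verts (pillow_glue n) (disj_union (aztec_diamond n) (aztec_diamond n))"


section \<open>Weighted paths and the graphs S and S'\<close>

definition weighted_path :: "nat \<Rightarrow> real \<Rightarrow> (nat, nat \<times> nat) wdigraph" where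
  "weighted_path m q =
     \<lparr>verts = {1..m},
      arcs = {(i, j). i \<in> {1..m} \<and> j \<in> {1..m} \<and> (j = i + 1 \<or> i = j + 1)},
      tail = fst,
      head = snd,
      weight = (\<lambda>_. q)\<rparr>"

text \<open>The path on the vertices \<open>1, \<dots>, m - 1\<close> with edge weight \<open>q\<close>, together with the extra
  vertex \<open>m\<close>, an arc of weight \<open>q\<close> from \<open>m\<close> to the last vertex \<open>m - 1\<close> of the path (and no arc
  back), and a loop of weight \<open>c\<close> at \<open>m\<close>. This is meaningful for \<open>m \<ge> 2\<close>.\<close>

definition path_with_loop :: "nat \<Rightarrow> real \<Rightarrow> real \<Rightarrow> (nat, nat \<times> nat) wdigraph" where
  "path_with_loop m q c =
     (let P = weighted_path (m - 1) q in
      \<lparr>verts = insert m (verts P),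
       arcs = arcs P \<union> {(m, m - 1), (m, m)},
       tail = fst,
       head = snd,
       weight = (weight P)((m, m - 1) := q, (m, m) := c)\<rparr>)"

definition S_graph :: "nat \<Rightarrow> (nat, nat \<times> nat) wdigraph" where
  "S_graph m = path_with_loop m 2 4"

definition S'_graph :: "nat \<Rightarrow> (nat, nat \<times> nat) wdigraph" where
  "S'_graph m = path_with_loop m (-2) (-4)"

end

theory Submission
  imports Defs "Jordan_Normal_Form.Determinant"
begin

text \<open>Functions on the pillowcase that are antisymmetric under swapping the two sheets vanish on the
  boundary and form one copy of \<open>AD\<^sub>n\<^sub>-\<^sub>1\<close>. On symmetric functions, in the coordinates \<open>x + y\<close> and
  \<open>x - y\<close>, the adjacency operator is the odd-parity half of \<open>D \<otimes> D\<close>, where \<open>D\<close> is the path on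
  \<open>2n + 1\<close> vertices reflected at its ends. The central difference \<open>\<Delta>\<close> intertwines \<open>D\<close> with the path
  on the \<open>2n - 1\<close> inner vertices, so \<open>\<Delta> \<otimes> \<Delta>\<close> maps onto the second copy of \<open>AD\<^sub>n\<^sub>-\<^sub>1\<close>. Its kernel
  consists of the functions \<open>g(w) + h(u)\<close>, on which the operator acts as \<open>2D\<close> on \<open>g\<close> and on \<open>h\<close>;
  modulo the alternating function \<open>2D\<close> is \<open>S\<^sub>2\<^sub>n\<close>, and modulo the constants it is \<open>S'\<^sub>2\<^sub>n\<close>. All these
  maps together form an explicit injective intertwiner between spaces of equal dimension.\<close>

section \<open>Similarity from an injective intertwiner\<close>

text \<open>The adjacency matrix as an operator on functions. Summing over outgoing arcs rather than
  over vertices handles parallel arcs without counting them.\<close>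

definition adj_op :: "('a, 'b) wdigraph \<Rightarrow> ('a \<Rightarrow> real) \<Rightarrow> 'a \<Rightarrow> real" where
  "adj_op G f u = (\<Sum>e \<in> {e \<in> arcs G. tail G e = u}. weight G e * f (head G e))"

lemma fin_digraph_truncate_iff:
  "fin_digraph (pre_digraph.truncate G) \<longleftrightarrow>
     finite (verts G) \<and> finite (arcs G) \<and>
     (\<forall>e \<in> arcs G. tail G e \<in> verts G \<and> head G e \<in> verts G)"
  unfolding fin_digraph_def fin_digraph_axioms_def wf_digraph_def
  by (auto simp: pre_digraph.truncate_def)

lemma sum_adj_entry:
  assumes "fin_digraph (pre_digraph.truncate G)"
  shows "(\<Sum>v \<in> verts G. adj_entry G u v * f v) = adj_op G f u"
proof -
  have fin: "finite (verts G)" "finite (arcs G)"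
    and hd: "\<And>e. e \<in> arcs G \<Longrightarrow> head G e \<in> verts G"
    using assms by (auto simp: fin_digraph_truncate_iff)
  have "(\<Sum>v \<in> verts G. adj_entry G u v * f v) =
      (\<Sum>v \<in> verts G. \<Sum>e \<in> {e \<in> {e \<in> arcs G. tail G e = u}. head G e = v}.
        weight G e * f (head G e))"
    unfolding adj_entry_def sum_distrib_right
    by (intro sum.cong refl) auto
  also have "\<dots> = adj_op G f u"
    unfolding adj_op_def by (rule sum.group) (use fin hd in auto)
  finally show ?thesis .
qed

lemma adj_op_outside:
  assumes "fin_digraph (pre_digraph.truncate G)" "u \<notin> verts G"
  shows "adj_op G f u = 0"
proof -
  have "{e \<in> arcs G. tail G e = u} = {}"
    using assms by (auto simp: fin_digraph_truncate_iff)
  then show ?thesis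
    unfolding adj_op_def by (simp only: sum.empty)
qed

lemma sum_nth_distinct:
  assumes "distinct xs" "set xs = A"
  shows "(\<Sum>i<length xs. f (xs ! i)) = sum f A"
  using assms sum.reindex_bij_betw[OF bij_betw_nth[OF assms(1) refl assms(2)[symmetric]], of f]
  by simp

text \<open>In the bases of indicator functions \<open>L\<close> has a square matrix
  \<open>Q\<close> with \<open>Q * A = B * Q\<close>. Injectivity makes \<open>Q\<close> invertible,
  so \<open>Q\<close> conjugates one adjacency matrix into the other.\<close>

lemma similar_graphs_if_injective_intertwiner:
  fixes G :: "('a, 'b) wdigraph" and H :: "('c, 'd) wdigraph"
    and L :: "('a \<Rightarrow> real) \<Rightarrow> 'c \<Rightarrow> real"
  assumes G: "fin_digraph (pre_digraph.truncate G)"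
    and H: "fin_digraph (pre_digraph.truncate H)"
    and card: "card (verts G) = card (verts H)"
    and add: "\<And>f g y. L (\<lambda>x. f x + g x) y = L f y + L g y"
    and scale: "\<And>c f y. L (\<lambda>x. c * f x) y = c * L f y"
    and intertwine: "\<And>f y. y \<in> verts H \<Longrightarrow> L (adj_op G f) y = adj_op H (L f) y"
    and inj: "\<And>f x. (\<And>y. y \<in> verts H \<Longrightarrow> L f y = 0) \<Longrightarrow> x \<in> verts G \<Longrightarrow> f x = 0"
  shows "similar_graphs G H"
  unfolding similar_graphs_def
proof (intro conjI allI impI G H)
  fix vs ws
  assume "vertex_enum G vs" "vertex_enum H ws"
  then have vs: "distinct vs" "set vs = verts G" and ws: "distinct ws" "set ws = verts H"
    by (auto simp: vertex_enum_def)
  define n where "n = length vs"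
  have n: "length vs = n" "length ws = n"
    using card distinct_card[OF vs(1)] distinct_card[OF ws(1)] vs(2) ws(2) by (simp_all add: n_def)
  have vs_in: "\<And>i. i < n \<Longrightarrow> vs ! i \<in> verts G" and ws_in: "\<And>i. i < n \<Longrightarrow> ws ! i \<in> verts H"
    using nth_mem[of _ vs] nth_mem[of _ ws] vs(2) ws(2) n by simp_all
  define \<delta> where "\<delta> = (\<lambda>v x :: 'a. if x = v then 1 else (0 :: real))"
  have lin: "L (\<lambda>x. \<Sum>i<m. c i * g i x) y = (\<Sum>i<m. c i * L (g i) y)" for m :: nat and c g y
  proof (induction m)
    case 0
    show ?case using scale[of 0 "\<lambda>_. 0" y] by simp
  next
    case (Suc m)
    then show ?case by (simp add: add scale)
  qed
  define A where "A = Defs.adj_mat G vs"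
  define B where "B = Defs.adj_mat H ws"
  define Q where "Q = mat n n (\<lambda>(i, j). L (\<delta> (vs ! j)) (ws ! i))"
  have dims: "A \<in> carrier_mat n n" "B \<in> carrier_mat n n" "Q \<in> carrier_mat n n"
    by (auto simp: A_def B_def Q_def Defs.adj_mat_def n)
  have QA: "Q * A = B * Q"
  proof (rule eq_matI)
    fix i j
    assume "i < dim_row (B * Q)" "j < dim_col (B * Q)"
    then have i: "i < n" and j: "j < n"
      using dims by auto
    \<comment> \<open>The expansion holds at every point, also off \<open>verts G\<close> where both
      sides vanish, so \<open>L\<close> may be applied to it as an identity of functions.\<close>
    have col: "adj_op G (\<delta> (vs ! j)) x = (\<Sum>k<n. A $$ (k, j) * \<delta> (vs ! k) x)" for x
    proof -
      have "(\<Sum>k<n. A $$ (k, j) * \<delta> (vs ! k) x)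
          = (\<Sum>k<length vs. adj_entry G (vs ! k) (vs ! j) * \<delta> (vs ! k) x)"
        using j by (intro sum.cong) (auto simp: A_def Defs.adj_mat_def n)
      also have "\<dots> = (\<Sum>v \<in> verts G. adj_entry G v (vs ! j) * \<delta> v x)"
        by (rule sum_nth_distinct[OF vs])
      also have "\<dots> = (if x \<in> verts G then adj_entry G x (vs ! j) else 0)"
        using G by (simp add: \<delta>_def fin_digraph_truncate_iff if_distrib cong: if_cong)
      also have "\<dots> = adj_op G (\<delta> (vs ! j)) x"
      proof (cases "x \<in> verts G")
        case True
        have "adj_op G (\<delta> (vs ! j)) x = (\<Sum>v \<in> verts G. adj_entry G x v * \<delta> (vs ! j) v)"
          by (rule sum_adj_entry[OF G, symmetric])
        also have "\<dots> = adj_entry G x (vs ! j)"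
          using G vs_in[OF j] by (simp add: \<delta>_def fin_digraph_truncate_iff if_distrib cong: if_cong)
        finally show ?thesis using True by simp
      qed (simp add: adj_op_outside[OF G])
      finally show ?thesis by simp
    qed
    have "(Q * A) $$ (i, j) = (\<Sum>k<n. A $$ (k, j) * L (\<delta> (vs ! k)) (ws ! i))"
      using i j dims by (simp add: scalar_prod_def Q_def lessThan_atLeast0 mult.commute)
    also have "\<dots> = L (adj_op G (\<delta> (vs ! j))) (ws ! i)"
      unfolding lin[symmetric] col[symmetric] ..
    also have "\<dots> = adj_op H (L (\<delta> (vs ! j))) (ws ! i)"
      by (rule intertwine[OF ws_in[OF i]])
    also have "\<dots> = (\<Sum>w \<in> verts H. adj_entry H (ws ! i) w * L (\<delta> (vs ! j)) w)"
      by (rule sum_adj_entry[OF H, symmetric])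
    also have "\<dots> = (\<Sum>k<length ws. adj_entry H (ws ! i) (ws ! k) * L (\<delta> (vs ! j)) (ws ! k))"
      by (rule sum_nth_distinct[OF ws, symmetric])
    also have "\<dots> = (B * Q) $$ (i, j)"
      using i j dims by (simp add: scalar_prod_def Q_def B_def Defs.adj_mat_def lessThan_atLeast0 n)
    finally show "(Q * A) $$ (i, j) = (B * Q) $$ (i, j)" .
  qed (use dims in auto)
  have "det Q \<noteq> 0"
  proof
    assume "det Q = 0"
    then obtain v where v: "v \<in> carrier_vec n" "v \<noteq> 0\<^sub>v n" "Q *\<^sub>v v = 0\<^sub>v n"
      using det_0_iff_vec_prod_zero[OF dims(3)] by auto
    \<comment> \<open>A kernel vector of \<open>Q\<close>, read as a function on the vertices, lies
      in the kernel of \<open>L\<close>.\<close>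
    define f where "f = (\<lambda>x. \<Sum>j<n. v $ j * \<delta> (vs ! j) x)"
    have "L f y = 0" if "y \<in> verts H" for y
    proof -
      have "y \<in> set ws" using that ws(2) by simp
      then obtain i where i: "i < n" "y = ws ! i"
        unfolding in_set_conv_nth n(2) by auto
      have "L f y = (\<Sum>j<n. v $ j * L (\<delta> (vs ! j)) y)"
        unfolding f_def by (rule lin)
      also have "\<dots> = (Q *\<^sub>v v) $ i"
        using i v(1) by (simp add: scalar_prod_def Q_def lessThan_atLeast0 mult.commute)
      finally show ?thesis using i v by simp
    qed
    then have f0: "f x = 0" if "x \<in> verts G" for x
      using inj[of f x] that by simp
    have "v $ i = 0" if i: "i < n" for i
    proof -
      have "f (vs ! i) = (\<Sum>j<n. if j = i then v $ j else 0)"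
        unfolding f_def \<delta>_def
        by (intro sum.cong) (use nth_eq_iff_index_eq[OF vs(1)] i n in auto)
      then show ?thesis using i f0[OF vs_in[OF i]] by simp
    qed
    then have "v = 0\<^sub>v n"
      using v(1) by (intro eq_vecI) auto
    then show False using v(2) by simp
  qed
  from det_non_zero_imp_unit[OF dims(3) this, of undefined]
  obtain R where R: "R \<in> carrier_mat n n" "R * Q = 1\<^sub>m n" "Q * R = 1\<^sub>m n"
    unfolding Units_def by (auto simp: ring_mat_simps)
  have "R * B * Q = R * (Q * A)"
    unfolding QA by (rule assoc_mult_mat[OF R(1) dims(2,3)])
  also have "\<dots> = R * Q * A"
    by (rule assoc_mult_mat[OF R(1) dims(3,1), symmetric])
  also have "\<dots> = A"
    unfolding R(2) by (rule left_mult_one_mat[OF dims(1)])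
  finally show "similar_mat (Defs.adj_mat G vs) (Defs.adj_mat H ws)"
    using similar_matI[of A B R Q n] R dims by (simp add: A_def B_def)
qed

section \<open>Adjacency operators of the constructions\<close>

lemma adj_op_add: "adj_op G (\<lambda>x. f x + g x) u = adj_op G f u + adj_op G g u"
  unfolding adj_op_def by (simp add: algebra_simps sum.distrib)

lemma adj_op_diff: "adj_op G (\<lambda>x. f x - g x) u = adj_op G f u - adj_op G g u"
  unfolding adj_op_def by (simp add: algebra_simps sum_subtractf)

lemma verts_disj_union [simp]: "verts (disj_union G H) = verts G <+> verts H"
  by (simp add: disj_union_def)

lemma fin_digraph_disj_union:
  assumes "fin_digraph (pre_digraph.truncate G)" "fin_digraph (pre_digraph.truncate H)"
  shows "fin_digraph (pre_digraph.truncate (disj_union G H))"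
  using assms by (auto simp: fin_digraph_truncate_iff disj_union_def)

lemma adj_op_disj_union [simp]:
  "adj_op (disj_union G H) f (Inl u) = adj_op G (f \<circ> Inl) u"
  "adj_op (disj_union G H) f (Inr v) = adj_op H (f \<circ> Inr) v"
proof -
  have "{e \<in> arcs (disj_union G H). tail (disj_union G H) e = Inl u} =
      Inl ` {e \<in> arcs G. tail G e = u}"
    by (auto simp: disj_union_def)
  then show "adj_op (disj_union G H) f (Inl u) = adj_op G (f \<circ> Inl) u"
    unfolding adj_op_def by (simp add: sum.reindex) (simp add: disj_union_def)
  have "{e \<in> arcs (disj_union G H). tail (disj_union G H) e = Inr v} =
      Inr ` {e \<in> arcs H. tail H e = v}"
    by (auto simp: disj_union_def)
  then show "adj_op (disj_union G H) f (Inr v) = adj_op H (f \<circ> Inr) v"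
    unfolding adj_op_def by (simp add: sum.reindex) (simp add: disj_union_def)
qed

lemma fin_digraph_identify_verts:
  assumes "fin_digraph (pre_digraph.truncate G)"
  shows "fin_digraph (pre_digraph.truncate (identify_verts h G))"
  using assms by (auto simp: fin_digraph_truncate_iff identify_verts_def)

text \<open>Every arc leaving \<open>v\<close> in the quotient leaves exactly one vertex of the
  fibre over \<open>v\<close>, so the fibre contributions add up.\<close>

lemma adj_op_identify_verts:
  assumes "fin_digraph (pre_digraph.truncate G)"
  shows "adj_op (identify_verts h G) f v = (\<Sum>x \<in> {x \<in> verts G. h x = v}. adj_op G (f \<circ> h) x)"
proof -
  have fin: "finite (verts G)" "finite (arcs G)"
    and tl: "\<And>e. e \<in> arcs G \<Longrightarrow> tail G e \<in> verts G"
    using assms by (auto simp: fin_digraph_truncate_iff)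
  have "(\<Sum>x \<in> {x \<in> verts G. h x = v}. adj_op G (f \<circ> h) x) =
     (\<Sum>x \<in> {x \<in> verts G. h x = v}. \<Sum>e \<in> {e \<in> {e \<in> arcs G. h (tail G e) = v}. tail G e = x}.
        weight G e * f (h (head G e)))"
    unfolding adj_op_def by (intro sum.cong) auto
  also have "\<dots> = (\<Sum>e \<in> {e \<in> arcs G. h (tail G e) = v}. weight G e * f (h (head G e)))"
    by (rule sum.group) (use fin tl in auto)
  finally show ?thesis
    by (simp add: adj_op_def identify_verts_def)
qed

lemma verts_path_with_loop: "m \<ge> 2 \<Longrightarrow> verts (path_with_loop m q c) = {1..m}"
  by (auto simp: path_with_loop_def weighted_path_def Let_def)

lemma fin_digraph_path_with_loop:
  assumes "m \<ge> 2"
  shows "fin_digraph (pre_digraph.truncate (path_with_loop m q c))"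
proof -
  have "finite (arcs (path_with_loop m q c))"
    by (rule finite_subset[of _ "{..m} \<times> {..m}"])
       (auto simp: path_with_loop_def weighted_path_def Let_def)
  then show ?thesis
    using assms
    by (auto simp: fin_digraph_truncate_iff path_with_loop_def weighted_path_def Let_def)
qed

text \<open>The vertex \<open>m - 1\<close> does not see \<open>m\<close>, since the connecting arc
  points only from \<open>m\<close> into the path.\<close>

lemma adj_op_path_with_loop:
  assumes "m \<ge> 2" "k \<in> {1..m}"
  shows "adj_op (path_with_loop m q c) f k =
    (if k = m then q * f (m - 1) + c * f m
     else q * ((if k = 1 then 0 else f (k - 1)) + (if k = m - 1 then 0 else f (k + 1))))"
proof -
  define W where "W = path_with_loop m q c"
  show ?thesis
  proof (cases "k = m")
    case True
    then have "{e \<in> arcs W. tail W e = k} = {(m, m - 1), (m, m)}"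
      using assms by (auto simp: W_def path_with_loop_def weighted_path_def Let_def)
    then show ?thesis
      using True assms unfolding W_def[symmetric] adj_op_def
      by (auto simp: W_def path_with_loop_def weighted_path_def Let_def)
  next
    case False
    have "{e \<in> arcs W. tail W e = k} =
      (if k = 1 then {} else {(k, k - 1)}) \<union> (if k = m - 1 then {} else {(k, k + 1)})"
      using False assms by (auto simp: W_def path_with_loop_def weighted_path_def Let_def)
    then have "adj_op W f k = (\<Sum>e \<in> (if k = 1 then {} else {(k, k - 1)}) \<union>
        (if k = m - 1 then {} else {(k, k + 1)}). weight W e * f (head W e))"
      unfolding adj_op_def by simp
    also have "\<dots> = (\<Sum>e \<in> (if k = 1 then {} else {(k, k - 1)}). weight W e * f (head W e)) +
        (\<Sum>e \<in> (if k = m - 1 then {} else {(k, k + 1)}). weight W e * f (head W e))"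
      by (rule sum.union_disjoint) auto
    also have "\<dots> =
      q * ((if k = 1 then 0 else f (k - 1)) + (if k = m - 1 then 0 else f (k + 1)))"
      using False by (auto simp: W_def path_with_loop_def weighted_path_def Let_def algebra_simps)
    finally show ?thesis
      using False by (simp add: W_def)
  qed
qed

section \<open>The path with reflecting ends\<close>

text \<open>The factor 2 at the ends is what \<open>g (k - 1) + g (k + 1)\<close> gives when
  \<open>g\<close> is extended evenly across \<open>0\<close> and \<open>N\<close>.\<close>

definition reflect_op :: "int \<Rightarrow> (int \<Rightarrow> real) \<Rightarrow> int \<Rightarrow> real" where
  "reflect_op N g k =
     (if k = 0 then 2 * g 1 else if k = N then 2 * g (N - 1) else g (k - 1) + g (k + 1))"

definition path_diff :: "(int \<Rightarrow> real) \<Rightarrow> int \<Rightarrow> real" where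
  "path_diff g k = g (k + 1) - g (k - 1)"

text \<open>The adjacency operator of the path on \<open>1, ..., N - 1\<close>. The terms at
  \<open>0\<close> and \<open>N\<close> are cut off explicitly because \<open>path_diff g\<close>
  reads \<open>g\<close> outside the interval there.\<close>

definition dirichlet_op :: "int \<Rightarrow> (int \<Rightarrow> real) \<Rightarrow> int \<Rightarrow> real" where
  "dirichlet_op N g k = (if k = 1 then 0 else g (k - 1)) + (if k = N - 1 then 0 else g (k + 1))"

text \<open>The central difference of a function reflected at \<open>0\<close> and \<open>N\<close> vanishes there.\<close>

lemma path_diff_reflect_op:
  assumes "1 \<le> k" "k \<le> N - 1"
  shows "path_diff (reflect_op N g) k = dirichlet_op N (path_diff g) k"
  using assms by (auto simp: path_diff_def reflect_op_def dirichlet_op_def algebra_simps)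

text \<open>Twice the sum of \<open>g\<close> over \<open>0, \<dots>, N\<close> with weight \<open>1/2\<close> at the two ends, which is the left
  eigenvector of \<^const>\<open>reflect_op\<close> for the eigenvalue \<open>2\<close>. Summing over edges makes the ends
  disappear from most computations.\<close>

definition edge_sum :: "nat \<Rightarrow> (int \<Rightarrow> real) \<Rightarrow> real" where
  "edge_sum N g = (\<Sum>k<N. g (int k) + g (int k + 1))"

lemma edge_sum_reflect_op:
  assumes "N \<ge> 1"
  shows "edge_sum N (reflect_op (int N) g) = 2 * edge_sum N g"
proof -
  \<comment> \<open>The deviation from the eigenvalue equation on one edge is a difference of
    consecutive central differences. These vanish at the ends for the even extension, so the sum
    telescopes to zero.\<close>
  define t where "t k = (if k = 0 \<or> k = N then 0 else path_diff g (int k))" for k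
  have step: "(reflect_op (int N) g (int k) + reflect_op (int N) g (int k + 1)) -
      2 * (g (int k) + g (int k + 1)) = t (Suc k) - t k" if "k < N" for k
  proof -
    have "Suc k = N \<longleftrightarrow> int k + 1 = int N" and "k \<noteq> N" "int k \<noteq> int N"
      using that by auto
    then show ?thesis
      unfolding reflect_op_def t_def path_diff_def by auto
  qed
  have "edge_sum N (reflect_op (int N) g) - 2 * edge_sum N g = (\<Sum>k<N. t (Suc k) - t k)"
    unfolding edge_sum_def sum_distrib_left sum_subtractf[symmetric]
    by (rule sum.cong) (use step in auto)
  also have "\<dots> = 0"
    unfolding sum_lessThan_telescope by (simp add: t_def)
  finally show ?thesis by simp
qed

text \<open>The component at \<open>N\<close> is forced: up to scaling it is the functional that turns
  \<^const>\<open>path_diff\<close> into an intertwiner to the path with loop.\<close>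

definition to_path_with_loop :: "int \<Rightarrow> (int \<Rightarrow> real) \<Rightarrow> int \<Rightarrow> real" where
  "to_path_with_loop N g k = (if k = N then - (g N + g (N - 1)) else path_diff g k)"

text \<open>Below \<open>N\<close> this is \<open>path_diff_reflect_op\<close>, as
  \<open>k = N - 1\<close> does not see \<open>N\<close>. At \<open>N\<close> both sides equal
  \<open>- (g (N - 2) + 2 * g (N - 1) + g N)\<close>.\<close>

lemma to_path_with_loop_reflect_op:
  assumes "2 \<le> N" "1 \<le> k" "k \<le> N"
  shows "to_path_with_loop N (reflect_op N g) k =
    (if k = N then to_path_with_loop N g (N - 1) + 2 * to_path_with_loop N g N
     else (if k = 1 then 0 else to_path_with_loop N g (k - 1)) +
       (if k = N - 1 then 0 else to_path_with_loop N g (k + 1)))"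
proof (cases "k = N")
  case True
  then show ?thesis
    using assms by (auto simp: to_path_with_loop_def reflect_op_def path_diff_def)
next
  case False
  then show ?thesis
    using assms path_diff_reflect_op[of k N g]
    by (auto simp: to_path_with_loop_def dirichlet_op_def)
qed

definition alt :: "int \<Rightarrow> real" where
  "alt k = (if even k then 1 else - 1)"

text \<open>Neighbors have opposite signs, so conjugation by \<open>alt\<close> negates the
  operator. It also exchanges constants and alternating functions, which is how
  \<open>S'_graph\<close> arises from the same map as \<open>S_graph\<close>.\<close>

lemma alt_reflect_op:
  assumes "even N"
  shows "alt k * reflect_op N g k = - reflect_op N (\<lambda>k. alt k * g k) k"
  using assms by (auto simp: alt_def reflect_op_def)

text \<open>Even and odd positions decouple under the central difference, so its kernel is described
  by the values at \<open>0\<close> and \<open>1\<close>.\<close>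

lemma period_two:
  assumes "\<And>k. 1 \<le> k \<Longrightarrow> k < N \<Longrightarrow> path_diff g k = 0" and "0 \<le> k" "k \<le> N"
  shows "g k = g (k mod 2)"
proof -
  have "\<forall>k. int n = k \<longrightarrow> k \<le> N \<longrightarrow> g k = g (k mod 2)" for n
  proof (induction n rule: less_induct)
    case (less n)
    show ?case
    proof (cases "n < 2")
      case True
      then show ?thesis by (auto simp: mod_pos_pos_trivial)
    next
      case False
      show ?thesis
      proof (intro allI impI)
        fix k :: int
        assume k: "int n = k" "k \<le> N"
        have "g (k - 2) = g ((k - 2) mod 2)"
          using less[of "n - 2"] False k by auto
        moreover have "g k = g (k - 2)"
          using assms(1)[of "k - 1"] k False by (simp add: path_diff_def)
        moreover have "(k - 2) mod 2 = k mod 2"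
          by presburger
        ultimately show "g k = g (k mod 2)" by simp
      qed
    qed
  qed
  then show ?thesis
    using assms(2,3) by (metis nonneg_int_cases)
qed

lemma edge_sum_period_two:
  assumes "\<And>k. 1 \<le> k \<Longrightarrow> k < int N \<Longrightarrow> path_diff g k = 0"
  shows "edge_sum N g = N * (g 0 + g 1)"
proof -
  have "g (int k) + g (int k + 1) = g 0 + g 1" if "k < N" for k
  proof -
    have "g (int k) = g (int k mod 2)" "g (int k + 1) = g ((int k + 1) mod 2)"
      using that by (auto intro: period_two[of "int N"] assms)
    moreover have "int k mod 2 = 0 \<and> (int k + 1) mod 2 = 1 \<or> int k mod 2 = 1 \<and> (int k + 1) mod 2 = 0"
      by presburger
    ultimately show ?thesis by auto
  qed
  then show ?thesis
    unfolding edge_sum_def by simp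
qed

lemma to_path_with_loop_cong:
  assumes "\<And>j. 0 \<le> j \<Longrightarrow> j \<le> N \<Longrightarrow> g j = h j" "2 \<le> N" "1 \<le> k" "k \<le> N"
  shows "to_path_with_loop N g k = to_path_with_loop N h k"
  using assms(2-) by (simp add: to_path_with_loop_def path_diff_def assms(1))

text \<open>The previous identities scaled by \<open>q\<close>: the eigenvalue 2 becomes a loop of
  weight \<open>2 * q\<close>. The values \<open>q = 2\<close> and \<open>q = - 2\<close> give the
  two graphs needed.\<close>

lemma adj_op_to_path_with_loop:
  assumes "2 \<le> N" "k \<in> {1..N}"
  shows "adj_op (path_with_loop N q (2 * q)) (\<lambda>j. to_path_with_loop (int N) g (int j)) k =
    to_path_with_loop (int N) (\<lambda>j. q * reflect_op (int N) g j) (int k)"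
proof -
  have "to_path_with_loop (int N) (\<lambda>j. q * reflect_op (int N) g j) (int k) =
      q * to_path_with_loop (int N) (reflect_op (int N) g) (int k)"
    by (simp add: to_path_with_loop_def path_diff_def algebra_simps)
  also have "\<dots> = adj_op (path_with_loop N q (2 * q)) (\<lambda>j. to_path_with_loop (int N) g (int j)) k"
    using assms
    by (subst to_path_with_loop_reflect_op)
       (auto simp: adj_op_path_with_loop of_nat_diff algebra_simps)
  finally show ?thesis by simp
qed

text \<open>For functions extended by zero the reflection is a mere factor at the ends, to be
  matched with the doubled arcs at the boundary of the pillowcase.\<close>

lemma reflect_op_vanishing_outside:
  assumes "0 < N" "g (- 1) = 0" "g (N + 1) = 0"
  shows "reflect_op N g k = (if k = 0 \<or> k = N then 2 else 1) * (g (k - 1) + g (k + 1))"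
  using assms by (simp add: reflect_op_def)

lemma reflect_op_add:
  "reflect_op N (\<lambda>k. g k + h k) k = reflect_op N g k + reflect_op N h k"
  by (simp add: reflect_op_def)

lemma reflect_op_diff:
  "reflect_op N (\<lambda>k. g k - h k) k = reflect_op N g k - reflect_op N h k"
  by (simp add: reflect_op_def)

lemma reflect_op_commute:
  "reflect_op N (\<lambda>u. reflect_op M (F u) w) u = reflect_op M (\<lambda>w. reflect_op N (\<lambda>u. F u w) u) w"
  by (auto simp: reflect_op_def)

lemma path_diff_commute:
  "path_diff (\<lambda>u. path_diff (F u) w) u = path_diff (\<lambda>w. path_diff (\<lambda>u. F u w) u) w"
  by (auto simp: path_diff_def)

lemma path_diff_reflect_op_commute:
  "path_diff (\<lambda>w. reflect_op N (\<lambda>u. F u w) u) w = reflect_op N (\<lambda>u. path_diff (F u) w) u"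
  by (auto simp: reflect_op_def path_diff_def)

lemma edge_sum_cong:
  assumes "\<And>k. 0 \<le> k \<Longrightarrow> k \<le> int N \<Longrightarrow> g k = h k"
  shows "edge_sum N g = edge_sum N h"
  unfolding edge_sum_def by (rule sum.cong) (use assms in auto)

lemma edge_sum_add: "edge_sum N (\<lambda>k. g k + h k) = edge_sum N g + edge_sum N h"
  unfolding edge_sum_def by (simp add: sum.distrib algebra_simps)

lemma edge_sum_diff: "edge_sum N (\<lambda>k. g k - h k) = edge_sum N g - edge_sum N h"
  unfolding edge_sum_def by (simp add: sum.distrib sum_subtractf algebra_simps)

lemma edge_sum_scale: "edge_sum N (\<lambda>k. c * g k) = c * edge_sum N g"
  unfolding edge_sum_def by (simp add: sum_distrib_left algebra_simps)

lemma edge_sum_reflect_op_commute: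
  "edge_sum N (\<lambda>u. reflect_op M (F u) w) = reflect_op M (\<lambda>w. edge_sum N (\<lambda>u. F u w)) w"
  by (auto simp: reflect_op_def edge_sum_add edge_sum_scale)

lemma edge_sum_path_diff_commute:
  "edge_sum N (\<lambda>u. path_diff (F u) w) = path_diff (\<lambda>w. edge_sum N (\<lambda>u. F u w)) w"
  by (simp add: path_diff_def edge_sum_diff)

section \<open>Aztec diamonds in diagonal coordinates\<close>

text \<open>With \<open>u = x + y + n\<close> and \<open>w = x - y + n\<close> the half-grid points are those with \<open>u + w\<close> odd,
  the diamond is the square \<open>0 \<le> u, w \<le> 2n\<close>, and neighbors differ by \<open>\<plusminus>1\<close> in both coordinates:
  adjacency becomes a tensor product of two paths.\<close>

definition diag_pt :: "nat \<Rightarrow> int \<Rightarrow> int \<Rightarrow> point" where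
  "diag_pt n u w = ((of_int u + of_int w) / 2 - real n, (of_int u - of_int w) / 2)"

text \<open>On the half-grid \<open>x + y\<close> and \<open>x - y\<close> are integers, so the
  floor only converts the type.\<close>

definition diag_u :: "nat \<Rightarrow> point \<Rightarrow> int" where
  "diag_u n p = \<lfloor>fst p + snd p\<rfloor> + int n"

definition diag_w :: "nat \<Rightarrow> point \<Rightarrow> int" where
  "diag_w n p = \<lfloor>fst p - snd p\<rfloor> + int n"

lemma diag_u_pt [simp]: "diag_u n (diag_pt n u w) = u"
proof -
  have "fst (diag_pt n u w) + snd (diag_pt n u w) = of_int (u - int n)"
    by (simp add: diag_pt_def field_simps)
  then show ?thesis unfolding diag_u_def by (simp only: floor_of_int)
qed

lemma diag_w_pt [simp]: "diag_w n (diag_pt n u w) = w"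
proof -
  have "fst (diag_pt n u w) - snd (diag_pt n u w) = of_int (w - int n)"
    by (simp add: diag_pt_def field_simps)
  then show ?thesis unfolding diag_w_def by (simp only: floor_of_int)
qed

lemma diag_pt_eq_iff [simp]: "diag_pt n u w = diag_pt n u' w' \<longleftrightarrow> u = u' \<and> w = w'"
  by (metis diag_u_pt diag_w_pt)

lemma diag_pt_in_half_grid: "diag_pt n u w \<in> half_grid \<longleftrightarrow> odd (u + w)"
proof
  assume "odd (u + w)"
  then obtain c where c: "u + w = 2 * c + 1" by (elim oddE)
  then have u: "u = 2 * c + 1 - w" by simp
  have "fst (diag_pt n u w) - 1/2 = of_int (c - int n)"
    "snd (diag_pt n u w) - 1/2 = of_int (c - w)"
    by (simp_all add: diag_pt_def u field_simps)
  then show "diag_pt n u w \<in> half_grid"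
    unfolding half_grid_def case_prod_beta mem_Collect_eq by (simp only: Ints_of_int)
next
  assume "diag_pt n u w \<in> half_grid"
  then obtain a where "fst (diag_pt n u w) - 1/2 = of_int a"
    unfolding half_grid_def by (auto simp: case_prod_beta elim: Ints_cases)
  then have "real_of_int (u + w) = of_int (2 * (a + int n) + 1)"
    by (simp add: diag_pt_def field_simps)
  then have "u + w = 2 * (a + int n) + 1"
    by (simp only: of_int_eq_iff)
  then show "odd (u + w)" by simp
qed

lemma half_grid_diag_pt:
  assumes "p \<in> half_grid"
  shows "diag_pt n (diag_u n p) (diag_w n p) = p"
proof -
  obtain a b where "fst p - 1/2 = of_int a" "snd p - 1/2 = of_int b"
    using assms unfolding half_grid_def by (auto simp: case_prod_beta elim!: Ints_cases)
  then have "p = diag_pt n (a + b + 1 + int n) (a - b + int n)"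
    by (auto simp: diag_pt_def prod_eq_iff field_simps)
  then show ?thesis by simp
qed

lemma norm1_diag_pt:
  "\<bar>fst (diag_pt n u w)\<bar> + \<bar>snd (diag_pt n u w)\<bar> = of_int (max \<bar>u - int n\<bar> \<bar>w - int n\<bar>)"
proof -
  have "\<bar>x\<bar> + \<bar>y\<bar> = max \<bar>x + y\<bar> \<bar>x - y\<bar>" for x y :: real
    by linarith
  moreover have "fst (diag_pt n u w) + snd (diag_pt n u w) = of_int (u - int n)"
    "fst (diag_pt n u w) - snd (diag_pt n u w) = of_int (w - int n)"
    by (simp_all add: diag_pt_def field_simps)
  ultimately show ?thesis
    by (simp del: of_int_diff add: of_int_max)
qed

text \<open>The offset \<open>n\<close> of the coordinates is independent of the radius
  \<open>m\<close>, so that the diamonds of orders \<open>n\<close> and \<open>n - 1\<close> share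
  one coordinate system.\<close>

lemma diag_pt_in_aztec_verts:
  "diag_pt n u w \<in> aztec_verts m \<longleftrightarrow>
     odd (u + w) \<and> \<bar>u - int n\<bar> \<le> int m \<and> \<bar>w - int n\<bar> \<le> int m"
proof -
  have "real_of_int (max \<bar>u - int n\<bar> \<bar>w - int n\<bar>) \<le> real m \<longleftrightarrow>
      max \<bar>u - int n\<bar> \<bar>w - int n\<bar> \<le> int m"
    unfolding of_int_of_nat_eq[symmetric, where 'a = real] of_int_le_iff ..
  then show ?thesis
    unfolding aztec_verts_def mem_Collect_eq norm1_diag_pt diag_pt_in_half_grid by auto
qed

lemma diag_pt_boundary:
  "\<bar>fst (diag_pt n u w)\<bar> + \<bar>snd (diag_pt n u w)\<bar> = real n \<longleftrightarrow>
     max \<bar>u - int n\<bar> \<bar>w - int n\<bar> = int n"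
  unfolding norm1_diag_pt of_int_of_nat_eq[symmetric, where 'a = real] of_int_eq_iff ..

lemma aztec_verts_cases:
  assumes "p \<in> aztec_verts m"
  obtains u w where "p = diag_pt n u w" "odd (u + w)"
    "\<bar>u - int n\<bar> \<le> int m" "\<bar>w - int n\<bar> \<le> int m"
proof -
  have "diag_pt n (diag_u n p) (diag_w n p) = p"
    using assms by (intro half_grid_diag_pt) (simp add: aztec_verts_def)
  then show thesis
    using assms diag_pt_in_aztec_verts[of n "diag_u n p" "diag_w n p" m]
    by (intro that[of "diag_u n p" "diag_w n p"]) auto
qed

text \<open>In diagonal coordinates exactly one of \<open>u\<close>, \<open>w\<close> is even.
  \<open>A\<close> collects the points with even \<open>u\<close>, with \<open>m + 1\<close> choices
  for \<open>u\<close> and \<open>m\<close> for \<open>w\<close>; \<open>A'\<close> is its mirror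
  image.\<close>

lemma card_aztec_verts: "finite (aztec_verts m) \<and> card (aztec_verts m) = 2 * m * (m + 1)"
proof -
  define A where "A = (\<lambda>(i, j). (2 * int i, 2 * int j + 1)) ` ({..m} \<times> {..<m})"
  define A' where "A' = prod.swap ` A"
  have cA: "card A = (m + 1) * m" "finite A"
    unfolding A_def by (subst card_image) (auto simp: inj_on_def)
  then have cA': "card A' = (m + 1) * m" "finite A'"
    unfolding A'_def by (auto simp: card_image)
  have "even (fst z)" if "z \<in> A" for z
    using that by (auto simp: A_def)
  moreover have "odd (fst z)" if "z \<in> A'" for z
    using that by (auto simp: A_def A'_def)
  ultimately have "A \<inter> A' = {}"
    by blast
  then have "card (A \<union> A') = 2 * m * (m + 1)"
    using cA cA' by (simp add: card_Un_disjoint algebra_simps)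
  moreover have "aztec_verts m = (\<lambda>(u, w). diag_pt m u w) ` (A \<union> A')"
  proof (intro subset_antisym subsetI)
    fix p assume "p \<in> aztec_verts m"
    then obtain u w where p: "p = diag_pt m u w" "odd (u + w)"
      "\<bar>u - int m\<bar> \<le> int m" "\<bar>w - int m\<bar> \<le> int m"
      by (rule aztec_verts_cases)
    have "(u, w) \<in> A \<union> A'"
    proof (cases "even u")
      case True
      then have "even u" "odd w"
        using p(2) by simp_all
      then obtain a b where "u = 2 * a" "w = 2 * b + 1"
        by (elim evenE oddE)
      then have "(u, w) = (2 * int (nat a), 2 * int (nat b) + 1)" "nat a \<le> m" "nat b < m"
        using p(3,4) by auto
      then show ?thesis unfolding A_def by force
    next
      case False
      then have "even w" "odd u"
        using p(2) by simp_all
      then obtain a b where "w = 2 * a" "u = 2 * b + 1"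
        by (elim evenE oddE)
      then have "(w, u) = (2 * int (nat a), 2 * int (nat b) + 1)" "nat a \<le> m" "nat b < m"
        using p(3,4) by auto
      then have "(w, u) \<in> A" unfolding A_def by force
      then show ?thesis unfolding A'_def by force
    qed
    then show "p \<in> (\<lambda>(u, w). diag_pt m u w) ` (A \<union> A')"
      using p(1) by force
  next
    fix p assume "p \<in> (\<lambda>(u, w). diag_pt m u w) ` (A \<union> A')"
    then show "p \<in> aztec_verts m"
      unfolding A_def A'_def by (auto simp: diag_pt_in_aztec_verts)
  qed
  moreover have "inj_on (\<lambda>(u, w). diag_pt m u w) (A \<union> A')"
    by (auto simp: inj_on_def)
  ultimately show ?thesis
    using cA cA' by (simp add: card_image)
qed

lemma verts_aztec_diamond [simp]: "verts (aztec_diamond m) = aztec_verts m"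
  by (simp add: aztec_diamond_def)

lemma fin_digraph_aztec_diamond: "fin_digraph (pre_digraph.truncate (aztec_diamond m))"
proof -
  have "finite {(p, q). p \<in> aztec_verts m \<and> q \<in> aztec_verts m \<and> nearest_neighbors p q}"
    by (rule finite_subset[of _ "aztec_verts m \<times> aztec_verts m"])
       (use card_aztec_verts in auto)
  then show ?thesis
    using card_aztec_verts[of m] by (auto simp: fin_digraph_truncate_iff aztec_diamond_def)
qed

text \<open>The 1-norm turns into the maximum norm. The differences of \<open>u\<close> and of
  \<open>w\<close> have equal parity, so a maximum of 1 forces both to be 1 in absolute
  value.\<close>

lemma nearest_neighbors_diag_pt:
  assumes "odd (u + w)" "odd (u' + w')"
  shows "nearest_neighbors (diag_pt n u w) (diag_pt n u' w') \<longleftrightarrow>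
    \<bar>u' - u\<bar> = 1 \<and> \<bar>w' - w\<bar> = 1"
proof -
  have norm1: "\<bar>x\<bar> + \<bar>y\<bar> = max \<bar>x + y\<bar> \<bar>x - y\<bar>" for x y :: real
    by linarith
  have "fst (diag_pt n u w) - fst (diag_pt n u' w') + (snd (diag_pt n u w) - snd (diag_pt n u' w'))
      = of_int (u - u')"
    "fst (diag_pt n u w) - fst (diag_pt n u' w') - (snd (diag_pt n u w) - snd (diag_pt n u' w'))
      = of_int (w - w')"
    by (simp_all add: diag_pt_def field_simps)
  then have "nearest_neighbors (diag_pt n u w) (diag_pt n u' w') \<longleftrightarrow>
      real_of_int (max \<bar>u' - u\<bar> \<bar>w' - w\<bar>) = 1"
    unfolding nearest_neighbors_def norm1
    by (simp only: of_int_max of_int_abs abs_minus_commute[of u'] abs_minus_commute[of w'])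
  also have "\<dots> \<longleftrightarrow> max \<bar>u' - u\<bar> \<bar>w' - w\<bar> = 1"
    unfolding of_int_eq_1_iff ..
  also have "\<dots> \<longleftrightarrow> \<bar>u' - u\<bar> = 1 \<and> \<bar>w' - w\<bar> = 1"
  proof -
    have "max a b = 1 \<longleftrightarrow> a = 1 \<and> b = 1" if "0 \<le> a" "0 \<le> b" "even a \<longleftrightarrow> even b" for a b :: int
      using that unfolding max_def by presburger
    then show ?thesis
      using assms by simp
  qed
  finally show ?thesis .
qed

text \<open>Extension by zero to all integer pairs, so that sums over neighbors need no case
  distinction at the boundary.\<close>

definition on_square :: "nat \<Rightarrow> nat \<Rightarrow> (point \<Rightarrow> real) \<Rightarrow> int \<Rightarrow> int \<Rightarrow> real" where
  "on_square m n h u w = (if diag_pt n u w \<in> aztec_verts m then h (diag_pt n u w) else 0)"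

lemma adj_op_aztec_diamond:
  assumes "diag_pt n u w \<in> aztec_verts m"
  shows "adj_op (aztec_diamond m) h (diag_pt n u w) =
    on_square m n h (u + 1) (w + 1) + on_square m n h (u + 1) (w - 1) +
    on_square m n h (u - 1) (w + 1) + on_square m n h (u - 1) (w - 1)"
proof -
  define p where "p = diag_pt n u w"
  define X where "X = {diag_pt n (u + 1) (w + 1), diag_pt n (u + 1) (w - 1),
    diag_pt n (u - 1) (w + 1), diag_pt n (u - 1) (w - 1)}"
  have uw: "odd (u + w)"
    using assms by (simp add: diag_pt_in_aztec_verts)
  have nb: "q \<in> aztec_verts m \<and> nearest_neighbors p q \<longleftrightarrow> q \<in> X \<and> q \<in> aztec_verts m" for q
  proof (cases "q \<in> aztec_verts m")
    case True
    then obtain u' w' where q: "q = diag_pt n u' w'" "odd (u' + w')"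
      by (rule aztec_verts_cases)
    have "\<bar>u' - u\<bar> = 1 \<and> \<bar>w' - w\<bar> = 1 \<longleftrightarrow>
      (u' = u + 1 \<or> u' = u - 1) \<and> (w' = w + 1 \<or> w' = w - 1)"
      by arith
    then show ?thesis
      unfolding p_def X_def q(1) using nearest_neighbors_diag_pt[OF uw q(2)] by auto
  qed simp
  have "{e \<in> arcs (aztec_diamond m). tail (aztec_diamond m) e = p} =
      Pair p ` {q. q \<in> aztec_verts m \<and> nearest_neighbors p q}"
    using assms by (auto simp: aztec_diamond_def p_def)
  also have "\<dots> = Pair p ` {q \<in> X. q \<in> aztec_verts m}"
    using nb by simp
  finally have "adj_op (aztec_diamond m) h p = (\<Sum>q \<in> {q \<in> X. q \<in> aztec_verts m}. h q)"
    unfolding adj_op_def by (simp add: sum.reindex inj_on_def) (simp add: aztec_diamond_def)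
  also have "\<dots> = (\<Sum>q \<in> X. if q \<in> aztec_verts m then h q else 0)"
    by (rule sum.inter_filter) (simp add: X_def)
  also have "\<dots> = on_square m n h (u + 1) (w + 1) + on_square m n h (u + 1) (w - 1) +
    on_square m n h (u - 1) (w + 1) + on_square m n h (u - 1) (w - 1)"
    unfolding X_def by (simp add: on_square_def)
  finally show ?thesis unfolding p_def .
qed

section \<open>The Aztec pillowcase\<close>

definition boundary :: "nat \<Rightarrow> point \<Rightarrow> bool" where
  "boundary n p \<longleftrightarrow> \<bar>fst p\<bar> + \<bar>snd p\<bar> = real n"

lemma pillow_glue_Inr: "pillow_glue n (Inr p) = (if boundary n p then Inl p else Inr p)"
  by (simp add: boundary_def)

text \<open>The 1-norm of a half-grid point is an integer, so being below \<open>n\<close> means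
  being at most \<open>n - 1\<close>.\<close>

lemma aztec_verts_not_boundary:
  assumes "n \<ge> 1"
  shows "p \<in> aztec_verts n \<and> \<not> boundary n p \<longleftrightarrow> p \<in> aztec_verts (n - 1)"
proof (cases "p \<in> half_grid")
  case True
  then obtain u w where p: "p = diag_pt n u w"
    using half_grid_diag_pt[of p n] by metis
  have "a \<le> int n \<and> b \<le> int n \<and> max a b \<noteq> int n \<longleftrightarrow> a \<le> int (n - 1) \<and> b \<le> int (n - 1)"
    for a b
    using assms by (auto simp: max_def)
  then show ?thesis
    unfolding p diag_pt_in_aztec_verts boundary_def diag_pt_boundary by blast
qed (simp add: aztec_verts_def)

lemma verts_aztec_pillowcase:
  assumes "n \<ge> 1"
  shows "verts (aztec_pillowcase n) = aztec_verts n <+> aztec_verts (n - 1)"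
proof -
  have "verts (aztec_pillowcase n) = pillow_glue n ` (aztec_verts n <+> aztec_verts n)"
    by (simp add: aztec_pillowcase_def identify_verts_def)
  also have "\<dots> = aztec_verts n <+> {p \<in> aztec_verts n. \<not> boundary n p}"
  proof -
    have "aztec_verts n = {p \<in> aztec_verts n. boundary n p} \<union> {p \<in> aztec_verts n. \<not> boundary n p}"
      by auto
    then have "(\<lambda>p. if boundary n p then Inl p else Inr p) ` aztec_verts n =
        (\<lambda>p. if boundary n p then Inl p else Inr p) `
          ({p \<in> aztec_verts n. boundary n p} \<union> {p \<in> aztec_verts n. \<not> boundary n p})"
      by (rule arg_cong)
    also have "\<dots> =
        Inl ` {p \<in> aztec_verts n. boundary n p} \<union> Inr ` {p \<in> aztec_verts n. \<not> boundary n p}"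
      unfolding image_Un by (intro arg_cong2[of _ _ _ _ "(\<union>)"] image_cong) auto
    finally show ?thesis
      unfolding Plus_def image_Un image_image pillow_glue.simps(1) pillow_glue_Inr by auto
  qed
  also have "{p \<in> aztec_verts n. \<not> boundary n p} = aztec_verts (n - 1)"
    using aztec_verts_not_boundary[OF assms] by auto
  finally show ?thesis .
qed

lemma fin_digraph_aztec_pillowcase: "fin_digraph (pre_digraph.truncate (aztec_pillowcase n))"
  unfolding aztec_pillowcase_def
  by (intro fin_digraph_identify_verts fin_digraph_disj_union fin_digraph_aztec_diamond)

text \<open>The pullback of \<open>f\<close> along the gluing to the second copy; it agrees with the
  upper sheet on the boundary.\<close>

definition lower_sheet :: "nat \<Rightarrow> (point + point \<Rightarrow> real) \<Rightarrow> point \<Rightarrow> real" where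
  "lower_sheet n f p = f (if boundary n p then Inl p else Inr p)"

text \<open>A boundary vertex has a preimage in each sheet and keeps the arcs of both.\<close>

lemma adj_op_aztec_pillowcase_Inl:
  assumes "p \<in> aztec_verts n"
  shows "adj_op (aztec_pillowcase n) f (Inl p) =
    adj_op (aztec_diamond n) (\<lambda>q. f (Inl q)) p +
    (if boundary n p then adj_op (aztec_diamond n) (lower_sheet n f) p else 0)"
proof -
  have "{x \<in> verts (disj_union (aztec_diamond n) (aztec_diamond n)). pillow_glue n x = Inl p} =
      (if boundary n p then {Inl p, Inr p} else {Inl p})"
    using assms by (auto simp: pillow_glue_Inr simp del: pillow_glue.simps(2) split: if_splits)
  moreover have "f \<circ> pillow_glue n \<circ> Inl = (\<lambda>q. f (Inl q))"
    "f \<circ> pillow_glue n \<circ> Inr = lower_sheet n f"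
    by (auto simp: fun_eq_iff lower_sheet_def pillow_glue_Inr simp del: pillow_glue.simps(2))
  ultimately show ?thesis
    unfolding aztec_pillowcase_def
    by (subst adj_op_identify_verts)
       (auto simp: fin_digraph_disj_union fin_digraph_aztec_diamond simp del: verts_disj_union)
qed

lemma adj_op_aztec_pillowcase_Inr:
  assumes "p \<in> aztec_verts n" "\<not> boundary n p"
  shows "adj_op (aztec_pillowcase n) f (Inr p) = adj_op (aztec_diamond n) (lower_sheet n f) p"
proof -
  have "{x \<in> verts (disj_union (aztec_diamond n) (aztec_diamond n)). pillow_glue n x = Inr p} =
      {Inr p}"
    using assms by (auto simp: pillow_glue_Inr simp del: pillow_glue.simps(2) split: if_splits)
  moreover have "f \<circ> pillow_glue n \<circ> Inr = lower_sheet n f"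
    by (auto simp: fun_eq_iff lower_sheet_def pillow_glue_Inr simp del: pillow_glue.simps(2))
  ultimately show ?thesis
    unfolding aztec_pillowcase_def
    by (subst adj_op_identify_verts)
       (auto simp: fin_digraph_disj_union fin_digraph_aztec_diamond simp del: verts_disj_union)
qed

definition antisym_part :: "nat \<Rightarrow> (point + point \<Rightarrow> real) \<Rightarrow> point \<Rightarrow> real" where
  "antisym_part n f p = f (Inl p) - lower_sheet n f p"

definition sym_part :: "nat \<Rightarrow> (point + point \<Rightarrow> real) \<Rightarrow> int \<Rightarrow> int \<Rightarrow> real" where
  "sym_part n f = on_square n n (\<lambda>p. f (Inl p) + lower_sheet n f p)"

lemma antisym_part_adj_op:
  assumes "n \<ge> 1" "p \<in> aztec_verts (n - 1)"
  shows "antisym_part n (adj_op (aztec_pillowcase n) f) p =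
    adj_op (aztec_diamond (n - 1)) (antisym_part n f) p"
proof -
  have p: "p \<in> aztec_verts n" "\<not> boundary n p"
    using aztec_verts_not_boundary[OF assms(1), of p] assms(2) by auto
  obtain u w where uw: "p = diag_pt n u w"
    by (rule aztec_verts_cases[OF p(1)])
  \<comment> \<open>The antisymmetric part vanishes on the boundary, so the larger diamond acts on
    it like the smaller one.\<close>
  have sq: "on_square n n (antisym_part n f) = on_square (n - 1) n (antisym_part n f)"
  proof (intro ext)
    fix u w
    show "on_square n n (antisym_part n f) u w = on_square (n - 1) n (antisym_part n f) u w"
      using aztec_verts_not_boundary[OF assms(1), of "diag_pt n u w"]
      by (auto simp: on_square_def antisym_part_def lower_sheet_def simp del: One_nat_def)
  qed
  have "antisym_part n (adj_op (aztec_pillowcase n) f) p =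
      adj_op (aztec_diamond n) (antisym_part n f) p"
    using p by (simp add: antisym_part_def[abs_def] lower_sheet_def[of n _ p] adj_op_diff
        adj_op_aztec_pillowcase_Inl adj_op_aztec_pillowcase_Inr)
  also have "\<dots> = adj_op (aztec_diamond (n - 1)) (antisym_part n f) p"
    using p assms(2) unfolding uw by (simp add: adj_op_aztec_diamond sq)
  finally show ?thesis .
qed

lemma sym_part_outside:
  "even (u + w) \<or> u < 0 \<or> w < 0 \<or> u > 2 * int n \<or> w > 2 * int n \<Longrightarrow> sym_part n f u w = 0"
  by (auto simp: sym_part_def on_square_def diag_pt_in_aztec_verts)

text \<open>Moving by one in both coordinates is a tensor product of two paths. A boundary vertex
  sees both sheets, which doubles the neighbor sum exactly as the reflection does.\<close>

lemma sym_part_adj_op: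
  assumes "n \<ge> 1" "0 \<le> u" "u \<le> 2 * int n" "0 \<le> w" "w \<le> 2 * int n"
  shows "sym_part n (adj_op (aztec_pillowcase n) f) u w =
    reflect_op (2 * int n) (\<lambda>u. reflect_op (2 * int n) (sym_part n f u) w) u"
proof -
  define d :: "int \<Rightarrow> real" where "d k = (if k = 0 \<or> k = 2 * int n then 2 else 1)" for k
  have "reflect_op (2 * int n) (sym_part n f u') w =
      d w * (sym_part n f u' (w - 1) + sym_part n f u' (w + 1))" for u'
    unfolding d_def
    by (rule reflect_op_vanishing_outside) (use assms in \<open>simp_all add: sym_part_outside\<close>)
  then have rhs: "reflect_op (2 * int n) (\<lambda>u. reflect_op (2 * int n) (sym_part n f u) w) u =
      d u * (d w * (sym_part n f (u - 1) (w - 1) + sym_part n f (u - 1) (w + 1)) +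
             d w * (sym_part n f (u + 1) (w - 1) + sym_part n f (u + 1) (w + 1)))"
    unfolding d_def
    by (subst reflect_op_vanishing_outside) (use assms in \<open>simp_all add: sym_part_outside\<close>)
  show ?thesis
  proof (cases "odd (u + w)")
    case False
    then show ?thesis
      unfolding rhs by (simp add: sym_part_outside)
  next
    case True
    define p where "p = diag_pt n u w"
    have abs_le: "\<bar>u - int n\<bar> \<le> int n" "\<bar>w - int n\<bar> \<le> int n"
      using assms by linarith+
    then have p: "p \<in> aztec_verts n"
      unfolding p_def diag_pt_in_aztec_verts using True by blast
    have "max a b = c \<longleftrightarrow> a = c \<or> b = c" if "a \<le> c" "b \<le> c" for a b c :: int
      using that by (auto simp: max_def)
    moreover have "\<bar>k - int n\<bar> = int n \<longleftrightarrow> k = 0 \<or> k = 2 * int n" for k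
      by linarith
    ultimately have "boundary n p \<longleftrightarrow> (u = 0 \<or> u = 2 * int n) \<or> (w = 0 \<or> w = 2 * int n)"
      unfolding p_def boundary_def diag_pt_boundary using abs_le by simp
    \<comment> \<open>The corners of the square have even \<open>u + w\<close> and carry no vertex,
      so the product \<open>d u * d w\<close> is never 4 at a vertex.\<close>
    moreover have "\<not> ((u = 0 \<or> u = 2 * int n) \<and> (w = 0 \<or> w = 2 * int n))"
      using True by auto
    ultimately have bd: "(if boundary n p then 2 else 1) = d u * d w"
      unfolding d_def by auto
    have "sym_part n (adj_op (aztec_pillowcase n) f) u w =
        (if boundary n p then 2 else 1) *
        adj_op (aztec_diamond n) (\<lambda>p. f (Inl p) + lower_sheet n f p) p"
      using p by (simp add: sym_part_def on_square_def p_def[symmetric] lower_sheet_def[of n _ p]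
          adj_op_add adj_op_aztec_pillowcase_Inl adj_op_aztec_pillowcase_Inr)
    also have "\<dots> = d u * d w *
        (sym_part n f (u + 1) (w + 1) + sym_part n f (u + 1) (w - 1) +
         sym_part n f (u - 1) (w + 1) + sym_part n f (u - 1) (w - 1))"
      unfolding bd using p by (simp add: adj_op_aztec_diamond sym_part_def p_def)
    finally show ?thesis
      unfolding rhs by (simp add: algebra_simps)
  qed
qed

text \<open>The projections of the symmetric part to functions of \<open>w\<close> alone and of \<open>u\<close> alone.\<close>

definition row_sum :: "nat \<Rightarrow> (point + point \<Rightarrow> real) \<Rightarrow> int \<Rightarrow> real" where
  "row_sum n f w = edge_sum (2 * n) (\<lambda>u. sym_part n f u w)"

definition col_sum :: "nat \<Rightarrow> (point + point \<Rightarrow> real) \<Rightarrow> int \<Rightarrow> real" where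
  "col_sum n f u = edge_sum (2 * n) (sym_part n f u)"

text \<open>Summation over \<open>u\<close> is a left eigenvector of the factor acting on
  \<open>u\<close>, with eigenvalue 2; the factor acting on \<open>w\<close> remains.\<close>

lemma row_sum_adj_op:
  assumes "n \<ge> 1" "0 \<le> w" "w \<le> 2 * int n"
  shows "row_sum n (adj_op (aztec_pillowcase n) f) w = 2 * reflect_op (2 * int n) (row_sum n f) w"
proof -
  have "row_sum n (adj_op (aztec_pillowcase n) f) w = edge_sum (2 * n)
      (reflect_op (2 * int n) (\<lambda>u. reflect_op (2 * int n) (sym_part n f u) w))"
    unfolding row_sum_def by (rule edge_sum_cong) (use assms sym_part_adj_op in auto)
  also have "\<dots> = 2 * edge_sum (2 * n) (\<lambda>u. reflect_op (2 * int n) (sym_part n f u) w)"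
    using edge_sum_reflect_op[of "2 * n"] assms by simp
  finally show ?thesis
    by (simp add: edge_sum_reflect_op_commute row_sum_def[abs_def])
qed

lemma col_sum_adj_op:
  assumes "n \<ge> 1" "0 \<le> u" "u \<le> 2 * int n"
  shows "col_sum n (adj_op (aztec_pillowcase n) f) u = 2 * reflect_op (2 * int n) (col_sum n f) u"
proof -
  have "col_sum n (adj_op (aztec_pillowcase n) f) u = edge_sum (2 * n)
      (reflect_op (2 * int n) (\<lambda>w. reflect_op (2 * int n) (\<lambda>u. sym_part n f u w) u))"
    unfolding col_sum_def
    by (rule edge_sum_cong) (use assms in \<open>simp add: sym_part_adj_op,
        simp only: reflect_op_commute[where F = "sym_part n f" and u = u]\<close>)
  also have "\<dots> = 2 * edge_sum (2 * n) (\<lambda>w. reflect_op (2 * int n) (\<lambda>u. sym_part n f u w) u)"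
    using edge_sum_reflect_op[of "2 * n"] assms by simp
  also have "\<dots> = 2 * reflect_op (2 * int n) (col_sum n f) u"
    using edge_sum_reflect_op_commute[of "2 * n" "2 * int n" "\<lambda>w u. sym_part n f u w" u]
    by (simp add: col_sum_def[abs_def])
  finally show ?thesis .
qed

definition cross_diff :: "nat \<Rightarrow> (point + point \<Rightarrow> real) \<Rightarrow> int \<Rightarrow> int \<Rightarrow> real" where
  "cross_diff n f u w = path_diff (\<lambda>u. path_diff (sym_part n f u) w) u"

text \<open>A difference in one variable commutes with the operator in the other, so the
  one-variable intertwining applies to each tensor factor.\<close>

lemma cross_diff_adj_op:
  assumes n: "n \<ge> 1" and uw: "1 \<le> u" "u \<le> 2 * int n - 1" "1 \<le> w" "w \<le> 2 * int n - 1"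
  shows "cross_diff n (adj_op (aztec_pillowcase n) f) u w =
    dirichlet_op (2 * int n) (\<lambda>u. dirichlet_op (2 * int n) (cross_diff n f u) w) u"
proof -
  let ?R = "reflect_op (2 * int n)" and ?D = "dirichlet_op (2 * int n)"
  have "cross_diff n (adj_op (aztec_pillowcase n) f) u w =
      path_diff (\<lambda>u. path_diff (\<lambda>w. ?R (\<lambda>u. ?R (sym_part n f u) w) u) w) u"
    unfolding cross_diff_def path_diff_def using assms by (simp add: sym_part_adj_op)
  also have "\<dots> = path_diff (?R (\<lambda>u. path_diff (?R (sym_part n f u)) w)) u"
    unfolding path_diff_reflect_op_commute ..
  also have "\<dots> = ?D (path_diff (\<lambda>u. ?D (path_diff (sym_part n f u)) w)) u"
    unfolding path_diff_reflect_op[OF uw(1,2)] path_diff_reflect_op[OF uw(3,4)] ..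
  also have "path_diff (\<lambda>u. ?D (path_diff (sym_part n f u)) w) = (\<lambda>u. ?D (cross_diff n f u) w)"
    unfolding cross_diff_def path_diff_def dirichlet_op_def by (auto simp: fun_eq_iff)
  finally show ?thesis .
qed

text \<open>The sum and the difference of the two projections are what removes the overlap between
  functions of \<open>w\<close> and functions of \<open>u\<close>: on points with \<open>u + w\<close> odd the functions \<open>(-1)^u\<close> and
  \<open>-(-1)^w\<close> coincide, as do the constants.\<close>

fun pillow_map ::
  "nat \<Rightarrow> (point + point \<Rightarrow> real) \<Rightarrow> (point + point) + (nat + nat) \<Rightarrow> real" where
  "pillow_map n f (Inl (Inl p)) = antisym_part n f p"
| "pillow_map n f (Inl (Inr p)) = cross_diff n f (diag_u n p) (diag_w n p)"
| "pillow_map n f (Inr (Inl k)) =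
    to_path_with_loop (2 * int n) (\<lambda>j. row_sum n f j + col_sum n f j) (int k)"
| "pillow_map n f (Inr (Inr k)) =
    to_path_with_loop (2 * int n) (\<lambda>j. alt j * (row_sum n f j - col_sum n f j)) (int k)"

section \<open>Linearity and the intertwining property of the map\<close>

lemma sym_part_add:
  "sym_part n (\<lambda>x. f x + g x) u = (\<lambda>w. sym_part n f u w + sym_part n g u w)"
  by (simp add: fun_eq_iff sym_part_def on_square_def lower_sheet_def)

lemma sym_part_scale: "sym_part n (\<lambda>x. c * f x) u = (\<lambda>w. c * sym_part n f u w)"
  by (simp add: fun_eq_iff sym_part_def on_square_def lower_sheet_def algebra_simps)

lemma pillow_map_add: "pillow_map n (\<lambda>x. f x + g x) y = pillow_map n f y + pillow_map n g y"
  by (induction n f y rule: pillow_map.induct)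
     (auto simp: antisym_part_def lower_sheet_def cross_diff_def path_diff_def sym_part_add
       to_path_with_loop_def row_sum_def col_sum_def edge_sum_add algebra_simps)

lemma pillow_map_scale: "pillow_map n (\<lambda>x. c * f x) y = c * pillow_map n f y"
  by (induction n f y rule: pillow_map.induct)
     (auto simp: antisym_part_def lower_sheet_def cross_diff_def path_diff_def sym_part_scale
       to_path_with_loop_def row_sum_def col_sum_def edge_sum_scale algebra_simps)

definition pillow_split :: "nat \<Rightarrow> ((point + point) + (nat + nat),
    (point \<times> point + point \<times> point) + (nat \<times> nat + nat \<times> nat)) wdigraph" where
  "pillow_split n = disj_union (disj_union (aztec_diamond (n - 1)) (aztec_diamond (n - 1)))
     (disj_union (S_graph (2 * n)) (S'_graph (2 * n)))"

lemma verts_pillow_split: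
  assumes "n \<ge> 1"
  shows "verts (pillow_split n) =
    (aztec_verts (n - 1) <+> aztec_verts (n - 1)) <+> ({1..2 * n} <+> {1..2 * n})"
  using assms by (simp add: pillow_split_def S_graph_def S'_graph_def verts_path_with_loop)

lemma pillow_map_adj_op:
  assumes n: "n \<ge> 1" and y: "y \<in> verts (pillow_split n)"
  shows "pillow_map n (adj_op (aztec_pillowcase n) f) y = adj_op (pillow_split n) (pillow_map n f) y"
proof -
  let ?A = "adj_op (aztec_pillowcase n)"
  consider (anti) p where "y = Inl (Inl p)" "p \<in> aztec_verts (n - 1)"
    | (cross) p where "y = Inl (Inr p)" "p \<in> aztec_verts (n - 1)"
    | (S) k where "y = Inr (Inl k)" "k \<in> {1..2 * n}"
    | (S') k where "y = Inr (Inr k)" "k \<in> {1..2 * n}"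
    using y unfolding verts_pillow_split[OF n] by blast
  then show ?thesis
  proof cases
    case anti
    then show ?thesis
      using antisym_part_adj_op[OF n anti(2), of f] by (simp add: pillow_split_def comp_def)
  next
    case cross
    let ?c = "\<lambda>p. cross_diff n f (diag_u n p) (diag_w n p)"
    obtain u w where p: "p = diag_pt n u w" and odd: "odd (u + w)"
      and "\<bar>u - int n\<bar> \<le> int (n - 1)" "\<bar>w - int n\<bar> \<le> int (n - 1)"
      by (rule aztec_verts_cases[OF cross(2)])
    then have uw: "1 \<le> u" "u \<le> 2 * int n - 1" "1 \<le> w" "w \<le> 2 * int n - 1"
      using n by linarith+
    \<comment> \<open>A cutoff to the inner interval. It expresses both the zero extension from the
      smaller diamond and the missing end terms of \<open>dirichlet_op\<close>.\<close>
    define z where "z k x = (if 1 \<le> k \<and> k \<le> 2 * int n - 1 then x else 0)" for k and x :: real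
    have sq: "on_square (n - 1) n ?c u' w' = z u' (z w' (cross_diff n f u' w'))"
      if "odd (u' + w')" for u' w'
    proof -
      have "\<bar>k - int n\<bar> \<le> int (n - 1) \<longleftrightarrow> 1 \<le> k \<and> k \<le> 2 * int n - 1" for k
        using n by linarith
      then show ?thesis
        using that by (simp add: on_square_def diag_pt_in_aztec_verts z_def)
    qed
    have dirichlet: "dirichlet_op (2 * int n) g k = z (k - 1) (g (k - 1)) + z (k + 1) (g (k + 1))"
      if "1 \<le> k" "k \<le> 2 * int n - 1" for g k
      using that by (auto simp: dirichlet_op_def z_def)
    have z_add: "z k (x + y) = z k x + z k y" for k x y
      by (simp add: z_def)
    have odds: "odd (u + 1 + (w + 1))" "odd (u + 1 + (w - 1))"
      "odd (u - 1 + (w + 1))" "odd (u - 1 + (w - 1))"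
      using odd by simp_all
    have "adj_op (aztec_diamond (n - 1)) ?c p =
        dirichlet_op (2 * int n) (\<lambda>u. dirichlet_op (2 * int n) (cross_diff n f u) w) u"
      unfolding p adj_op_aztec_diamond[OF cross(2)[unfolded p]] dirichlet[OF uw(1,2)]
        dirichlet[OF uw(3,4)] sq[OF odds(1)] sq[OF odds(2)] sq[OF odds(3)] sq[OF odds(4)] z_add
      by linarith
    then show ?thesis
      using cross_diff_adj_op[OF n uw, of f] cross(1)
      by (simp add: pillow_split_def comp_def p)
  next
    case S
    have "pillow_map n (?A f) y = to_path_with_loop (int (2 * n))
      (\<lambda>j. 2 * reflect_op (int (2 * n)) (\<lambda>j. row_sum n f j + col_sum n f j) j) (int k)"
      unfolding S(1) pillow_map.simps of_nat_mult of_nat_numeral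
      by (rule to_path_with_loop_cong)
         (use S n in \<open>auto simp: row_sum_adj_op col_sum_adj_op reflect_op_add\<close>)
    also have "\<dots> = adj_op (pillow_split n) (pillow_map n f) y"
      using adj_op_to_path_with_loop[OF _ S(2), of 2] S(1) n
      by (simp add: pillow_split_def S_graph_def comp_def)
    finally show ?thesis .
  next
    case S'
    \<comment> \<open>The sign from conjugating by \<open>alt\<close> turns the weight 2 into
      -2.\<close>
    have "alt j * (row_sum n (?A f) j - col_sum n (?A f) j) =
      - 2 * reflect_op (2 * int n) (\<lambda>j. alt j * (row_sum n f j - col_sum n f j)) j"
      if "0 \<le> j" "j \<le> 2 * int n" for j
    proof -
      have "row_sum n (?A f) j - col_sum n (?A f) j =
          2 * reflect_op (2 * int n) (\<lambda>j. row_sum n f j - col_sum n f j) j"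
        using that n by (simp add: row_sum_adj_op col_sum_adj_op reflect_op_diff)
      then have "alt j * (row_sum n (?A f) j - col_sum n (?A f) j) =
          2 * (alt j * reflect_op (2 * int n) (\<lambda>j. row_sum n f j - col_sum n f j) j)"
        by (simp only: mult.left_commute)
      also have "\<dots> = - 2 * reflect_op (2 * int n) (\<lambda>j. alt j * (row_sum n f j - col_sum n f j)) j"
        by (subst alt_reflect_op) simp_all
      finally show ?thesis .
    qed
    then have "pillow_map n (?A f) y = to_path_with_loop (int (2 * n))
      (\<lambda>j. - 2 * reflect_op (int (2 * n)) (\<lambda>j. alt j * (row_sum n f j - col_sum n f j)) j) (int k)"
      unfolding S'(1) pillow_map.simps of_nat_mult of_nat_numeral
      using S' n by (intro to_path_with_loop_cong) simp_all
    also have "\<dots> = adj_op (pillow_split n) (pillow_map n f) y"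
      using adj_op_to_path_with_loop[OF _ S'(2), of "- 2"] S'(1) n
      by (simp add: pillow_split_def S'_graph_def comp_def)
    finally show ?thesis .
  qed
qed

section \<open>Injectivity of the map\<close>

text \<open>As a function of \<open>u\<close> the difference in \<open>w\<close> has period two, so
  its edge sum is \<open>N\<close> times the sum of its values at \<open>0\<close> and
  \<open>1\<close>. One of these vanishes by parity, hence so does the other.\<close>

lemma path_diff_zero_if_edge_sum_zero:
  fixes F :: "int \<Rightarrow> int \<Rightarrow> real"
  assumes "N \<ge> 1"
    and parity: "\<And>u w. even (u + w) \<Longrightarrow> F u w = 0"
    and cross: "\<And>u. 1 \<le> u \<Longrightarrow> u < int N \<Longrightarrow> path_diff (\<lambda>u. path_diff (F u) w) u = 0"
    and sum: "path_diff (\<lambda>w. edge_sum N (\<lambda>u. F u w)) w = 0"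
    and u: "0 \<le> u" "u \<le> int N"
  shows "path_diff (F u) w = 0"
proof -
  define k where "k u = path_diff (F u) w" for u
  have cross': "\<And>u. 1 \<le> u \<Longrightarrow> u < int N \<Longrightarrow> path_diff k u = 0"
    using cross by (simp add: k_def[abs_def])
  have "N * (k 0 + k 1) = edge_sum N k"
    using edge_sum_period_two[OF cross'] by simp
  also have "\<dots> = 0"
    using sum by (simp add: k_def[abs_def] edge_sum_path_diff_commute)
  finally have "k 0 + k 1 = 0"
    using assms(1) by simp
  moreover have "k 0 = 0 \<or> k 1 = 0"
    by (cases "even w") (auto simp: k_def path_diff_def parity)
  ultimately have "k 0 = 0" "k 1 = 0"
    by auto
  moreover have "u mod 2 = 0 \<or> u mod 2 = 1"
    by presburger
  ultimately have "k u = 0"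
    using period_two[OF cross' u] by auto
  then show ?thesis by (simp add: k_def)
qed

text \<open>The differences force \<open>F\<close> to depend only on the parities of
  \<open>u\<close> and \<open>w\<close>, leaving the unknowns \<open>F 0 1\<close> and
  \<open>F 1 0\<close>. The last components of the two looped paths give their sum and their
  difference.\<close>

lemma pillow_map_zero_imp_sym_part_zero:
  assumes n: "n \<ge> 1" and zero: "\<And>y. y \<in> verts (pillow_split n) \<Longrightarrow> pillow_map n f y = 0"
    and uw: "0 \<le> u" "u \<le> 2 * int n" "0 \<le> w" "w \<le> 2 * int n"
  shows "sym_part n f u w = 0"
proof -
  define F where "F = sym_part n f"
  define N where "N = 2 * n"
  have N: "int N = 2 * int n" "N \<ge> 1"
    using n by (auto simp: N_def)
  have parity: "F u w = 0" if "even (u + w)" for u w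
    using that by (simp add: F_def sym_part_outside)
  have cross: "path_diff (\<lambda>u. path_diff (F u) w) u = 0"
    if "1 \<le> u" "u < int N" "1 \<le> w" "w < int N" for u w
  \<comment> \<open>For even \<open>u + w\<close> there is no vertex to test, but the mixed
    difference then only reads points where \<open>F\<close> vanishes.\<close>
  proof (cases "even (u + w)")
    case True
    then show ?thesis
      by (simp add: path_diff_def parity)
  next
    case False
    then have "diag_pt n u w \<in> aztec_verts (n - 1)"
      using that n by (auto simp: diag_pt_in_aztec_verts N_def)
    then have "pillow_map n f (Inl (Inr (diag_pt n u w))) = 0"
      by (intro zero, unfold verts_pillow_split[OF n]) blast
    then show ?thesis
      by (simp add: cross_diff_def F_def)
  qed
  have S: "to_path_with_loop (int N) (\<lambda>j. row_sum n f j + col_sum n f j) k = 0"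
    "to_path_with_loop (int N) (\<lambda>j. alt j * (row_sum n f j - col_sum n f j)) k = 0"
    if "1 \<le> k" "k \<le> int N" for k
  proof -
    have "nat k \<in> {1..2 * n}"
      using that N by auto
    then have "Inr (Inl (nat k)) \<in> verts (pillow_split n)" "Inr (Inr (nat k)) \<in> verts (pillow_split n)"
      unfolding verts_pillow_split[OF n] by blast+
    from this[THEN zero] show
      "to_path_with_loop (int N) (\<lambda>j. row_sum n f j + col_sum n f j) k = 0"
      "to_path_with_loop (int N) (\<lambda>j. alt j * (row_sum n f j - col_sum n f j)) k = 0"
      using that by (simp_all add: N)
  qed
  have row_col: "path_diff (row_sum n f) k = 0" "path_diff (col_sum n f) k = 0"
    if k: "1 \<le> k" "k < int N" for k
  proof -
    have "path_diff (row_sum n f) k + path_diff (col_sum n f) k = 0"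
      using S(1)[of k] k by (simp add: to_path_with_loop_def path_diff_def)
    moreover have "path_diff (row_sum n f) k - path_diff (col_sum n f) k = 0"
      using S(2)[of k] k
      \<comment> \<open>Both neighbors of \<open>k\<close> carry the same sign, so
        \<open>alt\<close> changes the central difference only by a sign.\<close>
      by (cases "even k") (simp_all add: to_path_with_loop_def path_diff_def alt_def)
    ultimately show "path_diff (row_sum n f) k = 0" "path_diff (col_sum n f) k = 0"
      by auto
  qed
  have sums: "row_sum n f = (\<lambda>w. edge_sum N (\<lambda>u. F u w))" "col_sum n f = (\<lambda>u. edge_sum N (F u))"
    by (auto simp: row_sum_def col_sum_def F_def N_def)
  have w_diff: "path_diff (F u) w = 0" if "0 \<le> u" "u \<le> int N" "1 \<le> w" "w < int N" for u w
  proof (rule path_diff_zero_if_edge_sum_zero[OF N(2) parity])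
    show "path_diff (\<lambda>u. path_diff (F u) w) u' = 0" if "1 \<le> u'" "u' < int N" for u'
      by (rule cross) (use that \<open>1 \<le> w\<close> \<open>w < int N\<close> in simp_all)
    show "path_diff (\<lambda>w. edge_sum N (\<lambda>u. F u w)) w = 0"
      using row_col(1)[OF \<open>1 \<le> w\<close> \<open>w < int N\<close>] unfolding sums .
  qed (use that in auto)
  have u_diff: "path_diff (\<lambda>u. F u w) u = 0" if "0 \<le> w" "w \<le> int N" "1 \<le> u" "u < int N" for u w
  proof (rule path_diff_zero_if_edge_sum_zero[of N "\<lambda>w u. F u w"])
    show "path_diff (\<lambda>w. path_diff (\<lambda>u. F u w) u) w' = 0" if "1 \<le> w'" "w' < int N" for w'
      using cross[OF \<open>1 \<le> u\<close> \<open>u < int N\<close> that] path_diff_commute[of F w' u] by simp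
    show "path_diff (\<lambda>u. edge_sum N (\<lambda>w. F u w)) u = 0"
      using row_col(2)[OF \<open>1 \<le> u\<close> \<open>u < int N\<close>] unfolding sums .
    show "F u' w' = 0" if "even (w' + u')" for u' w'
      using that by (intro parity) (simp add: add.commute)
  qed (use N(2) that in auto)
  have F_mod: "F u w = F (u mod 2) (w mod 2)" if "0 \<le> u" "u \<le> int N" "0 \<le> w" "w \<le> int N" for u w
  proof -
    have "F u w = F u (w mod 2)"
      by (rule period_two[of "int N"]) (use that w_diff in blast)+
    also have "\<dots> = F (u mod 2) (w mod 2)"
    proof (rule period_two[of "int N" "\<lambda>u. F u (w mod 2)"])
      have "w mod 2 \<ge> 0" "w mod 2 < 2" "2 \<le> int N"
        using N n by simp_all
      then have "w mod 2 \<ge> 0" "w mod 2 \<le> int N"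
        by linarith+
      then show "path_diff (\<lambda>u. F u (w mod 2)) k = 0" if "1 \<le> k" "k < int N" for k
        using that u_diff by blast
    qed (use that in auto)
    finally show ?thesis .
  qed
  have row: "row_sum n f w = N * (F 0 w + F 1 w)" if "0 \<le> w" "w \<le> int N" for w
    unfolding sums by (rule edge_sum_period_two) (rule u_diff[OF that])
  have col: "col_sum n f u = N * (F u 0 + F u 1)" if "0 \<le> u" "u \<le> int N" for u
    unfolding sums by (rule edge_sum_period_two) (rule w_diff[OF that])
  have mod: "int N mod 2 = 0" "(int N - 1) mod 2 = 1"
    unfolding N(1) by presburger+
  have diag: "F 0 0 = 0" "F 1 1 = 0"
    by (simp_all add: parity)
  have le: "0 \<le> int N" "int N \<le> int N" "0 \<le> int N - 1" "int N - 1 \<le> int N" "0 \<le> (0::int)"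
    "(0::int) \<le> 1" "1 \<le> int N"
    using N by simp_all
  have "row_sum n f (int N) = N * F 1 0" "row_sum n f (int N - 1) = N * F 0 1"
    unfolding row[OF le(1,2)] row[OF le(3,4)] F_mod[OF le(5,1,1,2)] F_mod[OF le(6,7,1,2)]
      F_mod[OF le(5,1,3,4)] F_mod[OF le(6,7,3,4)] mod
    by (simp_all add: diag)
  moreover have "col_sum n f (int N) = N * F 0 1" "col_sum n f (int N - 1) = N * F 1 0"
    unfolding col[OF le(1,2)] col[OF le(3,4)] F_mod[OF le(1,2,5,1)] F_mod[OF le(1,2,6,7)]
      F_mod[OF le(3,4,5,1)] F_mod[OF le(3,4,6,7)] mod
    by (simp_all add: diag)
  ultimately have ends: "row_sum n f (int N) = N * F 1 0" "row_sum n f (int N - 1) = N * F 0 1"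
    "col_sum n f (int N) = N * F 0 1" "col_sum n f (int N - 1) = N * F 1 0"
    by blast+
  \<comment> \<open>Each of \<open>F 0 1\<close> and \<open>F 1 0\<close> occurs twice among the
    four end values, once in a row sum and once in a column sum.\<close>
  have "N * (F 0 1 + F 1 0) = 0"
    using S(1)[OF le(7,2)] unfolding to_path_with_loop_def ends by (simp add: algebra_simps)
  then have "F 0 1 + F 1 0 = 0"
    using N(2) by simp
  moreover have "alt (int N) = 1" "alt (int N - 1) = - 1"
    by (auto simp: alt_def N_def)
  then have "N * (F 0 1 - F 1 0) = 0"
    using S(2)[OF le(7,2)] unfolding to_path_with_loop_def ends by (simp add: algebra_simps)
  then have "F 0 1 - F 1 0 = 0"
    using N(2) by simp
  ultimately have "F 0 1 = 0" "F 1 0 = 0"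
    by auto
  moreover have "u mod 2 = 0 \<or> u mod 2 = 1" "w mod 2 = 0 \<or> w mod 2 = 1"
    by presburger+
  moreover have "F u w = F (u mod 2) (w mod 2)"
    by (rule F_mod) (use uw in \<open>simp_all add: N\<close>)
  ultimately show ?thesis
    using parity[of 0 0] parity[of 1 1] by (auto simp: F_def)
qed

text \<open>Both the symmetric and the antisymmetric part vanish. On the boundary the symmetric part
  alone suffices, being \<open>2 * f (Inl p)\<close>.\<close>

lemma pillow_map_injective:
  assumes n: "n \<ge> 1" and zero: "\<And>y. y \<in> verts (pillow_split n) \<Longrightarrow> pillow_map n f y = 0"
    and x: "x \<in> verts (aztec_pillowcase n)"
  shows "f x = 0"
proof -
  have sum: "f (Inl p) + lower_sheet n f p = 0" if p: "p \<in> aztec_verts n" for p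
  proof -
    obtain u w where uw: "p = diag_pt n u w" "\<bar>u - int n\<bar> \<le> int n" "\<bar>w - int n\<bar> \<le> int n"
      by (rule aztec_verts_cases[OF p])
    then have "sym_part n f u w = 0"
      by (intro pillow_map_zero_imp_sym_part_zero[OF n zero]) auto
    then show ?thesis
      using p by (simp add: sym_part_def on_square_def uw(1))
  qed
  have diff: "f (Inl p) = f (Inr p) \<and> lower_sheet n f p = f (Inr p)"
    if p: "p \<in> aztec_verts (n - 1)" for p
  proof -
    have "Inl (Inl p) \<in> verts (pillow_split n)"
      using p unfolding verts_pillow_split[OF n] by blast
    then have "antisym_part n f p = 0"
      using zero[of "Inl (Inl p)"] by simp
    moreover have "\<not> boundary n p"
      using aztec_verts_not_boundary[OF n] p by blast
    ultimately show ?thesis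
      by (simp add: antisym_part_def lower_sheet_def)
  qed
  have upper: "f (Inl p) = 0" if p: "p \<in> aztec_verts n" for p
  proof (cases "boundary n p")
    case True
    then show ?thesis using sum[OF p] by (simp add: lower_sheet_def)
  next
    case False
    then have "p \<in> aztec_verts (n - 1)"
      using aztec_verts_not_boundary[OF n] p by blast
    then show ?thesis using sum[OF p] diff by simp
  qed
  have sub: "p \<in> aztec_verts n" if "p \<in> aztec_verts (n - 1)" for p
    using aztec_verts_not_boundary[OF n] that by blast
  from x[unfolded verts_aztec_pillowcase[OF n]] show ?thesis
  proof (rule PlusE)
    fix p assume "p \<in> aztec_verts n" "x = Inl p"
    then show ?thesis using upper by simp
  next
    fix p assume "p \<in> aztec_verts (n - 1)" "x = Inr p"
    then show ?thesis using upper[OF sub] diff by metis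
  qed
qed

text \<open>Both graphs have \<open>4 * n^2\<close> vertices.\<close>

lemma card_verts_pillowcase_split:
  assumes "n \<ge> 1"
  shows "card (verts (aztec_pillowcase n)) = card (verts (pillow_split n))"
proof -
  obtain m where "n = Suc m"
    using assms by (cases n) auto
  then show ?thesis
    using card_aztec_verts[of m] card_aztec_verts[of "Suc m"]
    by (simp add: verts_aztec_pillowcase verts_pillow_split card_Plus finite_Plus algebra_simps)
qed

theorem theorem6p1:
  fixes n :: nat
  assumes "n \<ge> 1"
  shows "similar_graphs (aztec_pillowcase n)
    (disj_union (disj_union (aztec_diamond (n - 1)) (aztec_diamond (n - 1)))
                (disj_union (S_graph (2 * n)) (S'_graph (2 * n))))"
  unfolding pillow_split_def[symmetric]
proof (rule similar_graphs_if_injective_intertwiner[where L = "pillow_map n"])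
  show "fin_digraph (pre_digraph.truncate (pillow_split n))"
    unfolding pillow_split_def S_graph_def S'_graph_def using assms
    by (intro fin_digraph_disj_union fin_digraph_aztec_diamond fin_digraph_path_with_loop) auto
qed (use assms in \<open>auto simp: fin_digraph_aztec_pillowcase card_verts_pillowcase_split
      pillow_map_add pillow_map_scale pillow_map_adj_op intro: pillow_map_injective\<close>)

end
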